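(* Let $Y$ be a Banach space, let $N\in\mathbb{N}$, and let $\{y_\alpha\}_\alpha\subset S_Y$ be a uniformly strongly exposed family with corresponding functionals $\{f_\alpha\}_\alpha\subset S_{Y^*}$. If $\{f_\alpha\}_\alpha$ is a norming subset for $Y$, then the pair $(\ell_1^N;Y)$ has property $\mathbf{L}_{p,p}$ (for operators).
   Context: Banach spaces are over $\mathbb{K}=\mathbb{R}$ or $\mathbb{C}$. $\ell_1^N$ is $\mathbb{K}^N$ with the norm $\|x\|_1=\sum_{j=1}^N|x_j|$. $S_X$, $B_X$, $X^*$ denote the unit sphere, closed unit ball and topological dual of $X$; $\mathcal{L}(X;Y)$ is the space of bounded linear operators from $X$ to $Y$ with the operator norm. A family $\{y_\alpha\}_\alpha\subset S_Y$ is uniformly strongly exposed with respect to (with corresponding functionals) a family $\{f_\alpha\}_\alpha\subset S_{Y^*}$ if there is a function $\varepsilon\in(0,1)\mapsto\delta(\varepsilon)>0$ such that $f_\alpha(y_\alpha)=1$ for all $\alpha$ and, for all $\alpha$ and $\varepsilon\in(0,1)$, whenever $y\in B_Y$ satisfies $\operatorname{Re}f_\alpha(y)>1-\delta(\varepsilon)$ one has $\|y-y_\alpha\|<\varepsilon$. $\{f_\alpha\}_\alpha\subset S_{Y^*}$ is norming for $Y$ if $\|y\|=\sup_\alpha|f_\alpha(y)|$ for every $y\in Y$. A pair $(X;Y)$ has property $\mathbf{L}_{p,p}$ (for operators) if for every $\varepsilon>0$ and $x\in S_X$ there is $\eta(\varepsilon,x)>0$ such that whenever $T\in\mathcal{L}(X;Y)$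 with $\|T\|=1$ satisfies $\|T(x)\|>1-\eta(\varepsilon,x)$, there is $S\in\mathcal{L}(X;Y)$ with $\|S\|=1$, $\|S(x)\|=1$ and $\|S-T\|<\varepsilon$. *)

theory Defs
  imports "HOL-Analysis.Analysis"
begin

section \<open>Scalars\<close>

text \<open>
  The scalar field is either the reals or the complex numbers. A type of this class is identified,
  as a normed real algebra, with one of these two subfields of the complex numbers.
\<close>

class real_or_complex = real_normed_field +
  fixes to_complex :: "'a \<Rightarrow> complex"
  assumes to_complex_add: "to_complex (a + b) = to_complex a + to_complex b"
    and to_complex_mult: "to_complex (a * b) = to_complex a * to_complex b"
    and to_complex_scaleR: "to_complex (scaleR r a) = scaleR r (to_complex a)"
    and to_complex_one: "to_complex 1 = 1"
    and norm_to_complex: "norm (to_complex a) = norm a"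
    and range_to_complex: "range to_complex = \<real> \<or> range to_complex = UNIV"

instantiation real :: real_or_complex
begin

definition to_complex_real :: "real \<Rightarrow> complex" where
  "to_complex_real = complex_of_real"

instance
proof
  show "range (to_complex :: real \<Rightarrow> complex) = \<real> \<or> range (to_complex :: real \<Rightarrow> complex) = UNIV"
    by (simp add: to_complex_real_def Reals_def)
qed (simp_all add: to_complex_real_def scaleR_conv_of_real)

end

instantiation complex :: real_or_complex
begin

definition to_complex_complex :: "complex \<Rightarrow> complex" where
  "to_complex_complex a = a"

instance
proof
  show "range (to_complex :: complex \<Rightarrow> complex) = \<real> \<or> range (to_complex :: complex \<Rightarrow> complex) = UNIV"
    by (simp add: to_complex_complex_def)
qed (simp_all add: to_complex_complex_def)

end

definition scalar_Re :: "'k::real_or_complex \<Rightarrow> real" where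
  "scalar_Re a = Re (to_complex a)"


section \<open>Normed spaces over the scalar field and their bounded operators\<close>

text \<open>
  The type class \<open>real_normed_vector\<close> only provides real scalars; multiplication by
  \<open>'k\<close> is an additional operation extending it.
\<close>

locale normed_space_over = vector_space scale
  for scale :: "'k::real_or_complex \<Rightarrow> 'a::real_normed_vector \<Rightarrow> 'a" +
  assumes scale_of_real: "scale (of_real r) x = r *\<^sub>R x"
    and norm_scale: "norm (scale a x) = norm a * norm x"

locale banach_space_over = normed_space_over scale
  for scale :: "'k::real_or_complex \<Rightarrow> 'a::banach \<Rightarrow> 'a"

text \<open>
  The operators that are linear over \<open>'k\<close>, inside the real bounded operators; the norm of
  the latter type is the operator norm.
\<close>

definition bounded_operators ::
  "('k \<Rightarrow> 'a \<Rightarrow> 'a) \<Rightarrow> ('k \<Rightarrow> 'b \<Rightarrow> 'b) \<Rightarrow> ('a::real_normed_vector \<Rightarrow>\<^sub>L 'b::real_normed_vector) set" where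
  "bounded_operators scaleX scaleY =
     {T. \<forall>a x. blinfun_apply T (scaleX a x) = scaleY a (blinfun_apply T x)}"

definition dual_sphere ::
  "('k::real_or_complex \<Rightarrow> 'a \<Rightarrow> 'a) \<Rightarrow> ('a::real_normed_vector \<Rightarrow>\<^sub>L 'k) set" where
  "dual_sphere scaleY = {f \<in> bounded_operators scaleY (*). norm f = 1}"


section \<open>The space of scalar N-tuples with the 1-norm\<close>

text \<open>The dimension is the cardinality of the finite type \<open>'n\<close>.\<close>

typedef ('k, 'n) ell1 = "UNIV :: ('k ^ 'n) set"
  morphisms vec_of_ell1 ell1_of_vec ..

lemmas ell1_simps [simp] = ell1_of_vec_inverse[OF UNIV_I] vec_of_ell1_inverse

instantiation ell1 :: (real_normed_vector, finite) real_normed_vector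
begin

definition zero_ell1 :: "('a, 'b) ell1" where
  "0 = ell1_of_vec 0"

definition plus_ell1 :: "('a, 'b) ell1 \<Rightarrow> ('a, 'b) ell1 \<Rightarrow> ('a, 'b) ell1" where
  "x + y = ell1_of_vec (vec_of_ell1 x + vec_of_ell1 y)"

definition minus_ell1 :: "('a, 'b) ell1 \<Rightarrow> ('a, 'b) ell1 \<Rightarrow> ('a, 'b) ell1" where
  "x - y = ell1_of_vec (vec_of_ell1 x - vec_of_ell1 y)"

definition uminus_ell1 :: "('a, 'b) ell1 \<Rightarrow> ('a, 'b) ell1" where
  "- x = ell1_of_vec (- vec_of_ell1 x)"

definition scaleR_ell1 :: "real \<Rightarrow> ('a, 'b) ell1 \<Rightarrow> ('a, 'b) ell1" where
  "scaleR r x = ell1_of_vec (scaleR r (vec_of_ell1 x))"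

definition norm_ell1 :: "('a, 'b) ell1 \<Rightarrow> real" where
  "norm_ell1 x = (\<Sum>j\<in>UNIV. norm (vec_of_ell1 x $ j))"

definition dist_ell1 :: "('a, 'b) ell1 \<Rightarrow> ('a, 'b) ell1 \<Rightarrow> real" where
  "dist_ell1 x y = norm (x - y)"

definition sgn_ell1 :: "('a, 'b) ell1 \<Rightarrow> ('a, 'b) ell1" where
  "sgn_ell1 x = scaleR (inverse (norm x)) x"

definition uniformity_ell1 :: "(('a, 'b) ell1 \<times> ('a, 'b) ell1) filter" where
  "uniformity_ell1 = (INF e\<in>{0<..}. principal {(x, y). dist x y < e})"

definition open_ell1 :: "('a, 'b) ell1 set \<Rightarrow> bool" where
  "open_ell1 U \<longleftrightarrow> (\<forall>x\<in>U. \<forall>\<^sub>F (x', y) in uniformity. x' = x \<longrightarrow> y \<in> U)"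

instance
proof
  fix x y :: "('a, 'b) ell1" and r :: real
  show "norm x = 0 \<longleftrightarrow> x = 0"
  proof -
    have "norm x = 0 \<longleftrightarrow> vec_of_ell1 x = 0"
      by (simp add: norm_ell1_def sum_nonneg_eq_0_iff vec_eq_iff)
    also have "\<dots> \<longleftrightarrow> x = 0"
      by (metis ell1_simps zero_ell1_def)
    finally show ?thesis .
  qed
  show "norm (x + y) \<le> norm x + norm y"
    by (simp add: norm_ell1_def plus_ell1_def sum.distrib[symmetric] sum_mono norm_triangle_ineq)
  show "norm (scaleR r x) = \<bar>r\<bar> * norm x"
    by (simp add: norm_ell1_def scaleR_ell1_def sum_distrib_left)
qed (simp_all add: zero_ell1_def plus_ell1_def minus_ell1_def uminus_ell1_def scaleR_ell1_def
      dist_ell1_def sgn_ell1_def uniformity_ell1_def open_ell1_def algebra_simps)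

end

definition ell1_scale :: "'k::times \<Rightarrow> ('k, 'n::finite) ell1 \<Rightarrow> ('k, 'n) ell1" where
  "ell1_scale a x = ell1_of_vec (\<chi> j. a * vec_of_ell1 x $ j)"

lemma of_real_to_scaleR: "of_real r * (a :: 'k::real_normed_field) = r *\<^sub>R a"
  by (simp add: scaleR_conv_of_real)

lemma normed_space_over_ell1:
  "normed_space_over (ell1_scale :: 'k::real_or_complex \<Rightarrow> ('k, 'n::finite) ell1 \<Rightarrow> ('k, 'n) ell1)"
proof
  fix a b :: 'k and x y :: "('k, 'n) ell1" and r :: real
  show "ell1_scale a (x + y) = ell1_scale a x + ell1_scale a y"
    and "ell1_scale (a + b) x = ell1_scale a x + ell1_scale b x"
    by (auto simp: ell1_scale_def plus_ell1_def algebra_simps vec_eq_iff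
        intro!: arg_cong[where f = ell1_of_vec])
  show "ell1_scale a (ell1_scale b x) = ell1_scale (a * b) x" and "ell1_scale 1 x = x"
    by (simp_all add: ell1_scale_def mult.assoc)
  show "ell1_scale (of_real r) x = r *\<^sub>R x"
    by (auto simp: ell1_scale_def scaleR_ell1_def of_real_to_scaleR vec_eq_iff
        intro!: arg_cong[where f = ell1_of_vec])
  show "norm (ell1_scale a x) = norm a * norm x"
    by (simp add: ell1_scale_def norm_ell1_def norm_mult sum_distrib_left)
qed


section \<open>Exposed families, norming families, and the property\<close>

definition uniformly_strongly_exposed ::
  "('k::real_or_complex \<Rightarrow> 'y \<Rightarrow> 'y) \<Rightarrow> 'i set \<Rightarrow> ('i \<Rightarrow> 'y) \<Rightarrow> ('i \<Rightarrow> 'y::real_normed_vector \<Rightarrow>\<^sub>L 'k) \<Rightarrow> bool" where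
  "uniformly_strongly_exposed scaleY I y f \<longleftrightarrow>
     (\<forall>i\<in>I. y i \<in> sphere 0 1 \<and> f i \<in> dual_sphere scaleY) \<and>
     (\<exists>\<delta> :: real \<Rightarrow> real.
        (\<forall>\<epsilon>\<in>{0<..<1}. \<delta> \<epsilon> > 0) \<and>
        (\<forall>i\<in>I. blinfun_apply (f i) (y i) = 1) \<and>
        (\<forall>i\<in>I. \<forall>\<epsilon>\<in>{0<..<1}. \<forall>z\<in>cball 0 1.
           scalar_Re (blinfun_apply (f i) z) > 1 - \<delta> \<epsilon> \<longrightarrow> norm (z - y i) < \<epsilon>))"

text \<open>
  For an empty family, \<open>norming\<close> makes the norm constant, hence the space trivial, whatever the
  value of the empty supremum.
\<close>

definition norming ::
  "('k::real_or_complex \<Rightarrow> 'y \<Rightarrow> 'y) \<Rightarrow> 'i set \<Rightarrow> ('i \<Rightarrow> 'y::real_normed_vector \<Rightarrow>\<^sub>L 'k) \<Rightarrow> bool" where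
  "norming scaleY I f \<longleftrightarrow>
     (\<forall>i\<in>I. f i \<in> dual_sphere scaleY) \<and>
     (\<forall>z. norm z = (SUP i\<in>I. norm (blinfun_apply (f i) z)))"

definition property_Lpp ::
  "('k::real_or_complex \<Rightarrow> 'x::real_normed_vector \<Rightarrow> 'x) \<Rightarrow> ('k \<Rightarrow> 'y::real_normed_vector \<Rightarrow> 'y) \<Rightarrow> bool" where
  "property_Lpp scaleX scaleY \<longleftrightarrow>
     (\<forall>\<epsilon>>0. \<forall>x\<in>sphere 0 1. \<exists>\<eta>>0.
        \<forall>T\<in>bounded_operators scaleX scaleY.
          norm T = 1 \<and> norm (blinfun_apply T x) > 1 - \<eta> \<longrightarrow>
          (\<exists>S\<in>bounded_operators scaleX scaleY.
             norm S = 1 \<and> norm (blinfun_apply S x) = 1 \<and> norm (S - T) < \<epsilon>))"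

end

(* An operator T on the N-dimensional l1-space is determined by the vectors T e_j, and its norm is
   their maximal norm. If |f_i (T x)| is close to 1, then, after rotating by a unimodular scalar c,
   the convex combination of the numbers Re (c u_j f_i (T e_j)) with weights |x_j|, where
   u_j = x_j / |x_j|, is close to 1; since N is finite and x is fixed, each of them with x_j \<noteq> 0 is
   close to 1, so strong exposedness puts c u_j T e_j near y_i. Replacing T e_j by
   (c u_j)^{-1} y_i on the support of x gives the operator S. *)
theory Submission
  imports Defs
begin

section \<open>The real part of a scalar\<close>

lemma scalar_Re_scaleR: "scalar_Re (r *\<^sub>R a) = r * scalar_Re a"
  by (simp add: scalar_Re_def to_complex_scaleR)

lemma scalar_Re_of_real [simp]: "scalar_Re (of_real r :: 'k::real_or_complex) = r"
  using scalar_Re_scaleR[of r "1::'k"]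
  by (simp add: of_real_def scalar_Re_def to_complex_one)

lemma scalar_Re_sum: "scalar_Re (sum g A) = (\<Sum>j\<in>A. scalar_Re (g j))"
proof -
  have "scalar_Re (0 :: 'a) = 0"
    using scalar_Re_scaleR[of 0 "0::'a"] by simp
  then show ?thesis
    by (induction A rule: infinite_finite_induct) (simp_all add: scalar_Re_def to_complex_add)
qed

lemma scalar_Re_le_norm: "scalar_Re a \<le> norm a"
  unfolding scalar_Re_def using complex_Re_le_cmod[of "to_complex a"]
  by (simp add: norm_to_complex)

text \<open>The defects \<open>w k * (1 - g k)\<close> are nonnegative and add up to one minus the
  mean, so no single one can reach \<eta>. Closeness of \<open>g j\<close> to 1 then costs a
  division by \<open>w j\<close>.\<close>

lemma weighted_mean_near_bound:
  fixes w g :: "'i \<Rightarrow> real"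
  assumes "finite A" "j \<in> A"
    and w: "\<And>k. k \<in> A \<Longrightarrow> 0 \<le> w k" "sum w A = 1"
    and g: "\<And>k. k \<in> A \<Longrightarrow> g k \<le> 1"
    and big: "(\<Sum>k\<in>A. w k * g k) > 1 - \<eta>"
  shows "w j * (1 - g j) < \<eta>"
proof -
  have "w j * (1 - g j) \<le> (\<Sum>k\<in>A. w k * (1 - g k))"
    using assms(1,2) by (intro member_le_sum) (auto intro!: mult_nonneg_nonneg w(1) simp: g)
  also have "\<dots> = 1 - (\<Sum>k\<in>A. w k * g k)"
    using w(2) by (simp add: right_diff_distrib sum_subtractf)
  finally show ?thesis using big by simp
qed


section \<open>Operators on the 1-norm space\<close>

definition ell1_axis :: "'n \<Rightarrow> ('k::real_or_complex, 'n::finite) ell1" where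
  "ell1_axis j = ell1_of_vec (axis j 1)"

lemma vec_of_ell1_sum: "vec_of_ell1 (sum g A) = (\<Sum>j\<in>A. vec_of_ell1 (g j))"
  by (induction A rule: infinite_finite_induct) (simp_all add: zero_ell1_def plus_ell1_def)

lemma ell1_basis_expansion:
  fixes x :: "('k::real_or_complex, 'n::finite) ell1"
  shows "(\<Sum>j\<in>UNIV. ell1_scale (vec_of_ell1 x $ j) (ell1_axis j)) = x"
proof -
  have "vec_of_ell1 (\<Sum>j\<in>UNIV. ell1_scale (vec_of_ell1 x $ j) (ell1_axis j)) = vec_of_ell1 x"
    by (simp add: vec_of_ell1_sum ell1_scale_def ell1_axis_def vec_eq_iff axis_def if_distrib
        cong: if_cong)
  then show ?thesis by (metis ell1_simps(2))
qed

lemma norm_ell1_axis [simp]: "norm (ell1_axis j :: ('k::real_or_complex, 'n::finite) ell1) = 1"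
  by (simp add: norm_ell1_def ell1_axis_def axis_def if_distrib cong: if_cong)

lemma bounded_operators_diff:
  assumes "normed_space_over scaleY" "S \<in> bounded_operators scaleX scaleY"
    and "T \<in> bounded_operators scaleX scaleY"
  shows "S - T \<in> bounded_operators scaleX scaleY"
proof -
  interpret normed_space_over scaleY by fact
  show ?thesis using assms(2,3)
    by (simp add: bounded_operators_def blinfun.diff_left scale_right_diff_distrib)
qed

lemma ell1_operator_apply:
  fixes T :: "('k::real_or_complex, 'n::finite) ell1 \<Rightarrow>\<^sub>L 'y::real_normed_vector"
  assumes "T \<in> bounded_operators ell1_scale scaleY"
  shows "T x = (\<Sum>j\<in>UNIV. scaleY (vec_of_ell1 x $ j) (T (ell1_axis j)))"
proof -
  have "T x = T (\<Sum>j\<in>UNIV. ell1_scale (vec_of_ell1 x $ j) (ell1_axis j))"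
    by (simp add: ell1_basis_expansion)
  also have "\<dots> = (\<Sum>j\<in>UNIV. scaleY (vec_of_ell1 x $ j) (T (ell1_axis j)))"
    using assms by (simp add: blinfun.sum_right bounded_operators_def)
  finally show ?thesis .
qed

lemma norm_scaled_sum_le:
  fixes x :: "('k::real_or_complex, 'n::finite) ell1"
  assumes "normed_space_over scaleY" "\<And>j. norm (v j) \<le> B"
  shows "norm (\<Sum>j\<in>UNIV. scaleY (vec_of_ell1 x $ j) (v j)) \<le> B * norm x"
proof -
  interpret normed_space_over scaleY by fact
  have "norm (\<Sum>j\<in>UNIV. scaleY (vec_of_ell1 x $ j) (v j))
      \<le> (\<Sum>j\<in>UNIV. norm (vec_of_ell1 x $ j) * B)"
    by (intro sum_norm_le) (simp add: norm_scale mult_left_mono assms(2))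
  then show ?thesis by (simp add: norm_ell1_def sum_distrib_left mult.commute)
qed

text \<open>By the triangle inequality, \<open>T x\<close> is bounded through the images of the axes
  with weights adding up to \<open>norm x\<close>. This serves both for \<open>S\<close> and for
  \<open>S - T\<close>.\<close>

lemma norm_ell1_operator_le:
  fixes T :: "('k::real_or_complex, 'n::finite) ell1 \<Rightarrow>\<^sub>L 'y::real_normed_vector"
  assumes "normed_space_over scaleY" "T \<in> bounded_operators ell1_scale scaleY"
    and "\<And>j. norm (T (ell1_axis j)) \<le> B"
  shows "norm T \<le> B"
proof (rule norm_blinfun_bound)
  show "0 \<le> B" using assms(3) norm_ge_zero order_trans by blast
  show "norm (T x) \<le> B * norm x" for x
    unfolding ell1_operator_apply[OF assms(2), of x]
    using norm_scaled_sum_le[OF assms(1), of "\<lambda>j. T (ell1_axis j)"] assms(3) by blast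
qed

text \<open>The values \<open>v\<close> are arbitrary: there are finitely many of them, so the sum
  of their norms bounds the linear extension.\<close>

lemma ell1_operator_exists:
  fixes v :: "'n::finite \<Rightarrow> 'y::real_normed_vector"
    and scaleY :: "'k::real_or_complex \<Rightarrow> 'y \<Rightarrow> 'y"
  assumes "normed_space_over scaleY"
  obtains S where "S \<in> bounded_operators ell1_scale scaleY" "\<And>j. blinfun_apply S (ell1_axis j) = v j"
proof -
  interpret normed_space_over scaleY by fact
  define L where "L x = (\<Sum>j\<in>UNIV. scaleY (vec_of_ell1 x $ j) (v j))" for x :: "('k, 'n) ell1"
  have scaleR: "scaleY (r *\<^sub>R a) z = r *\<^sub>R scaleY a z" for r a z
    by (metis scale_of_real scale_scale scaleR_conv_of_real)
  have "bounded_linear L"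
  proof (rule bounded_linear_intro)
    show "L (x + x') = L x + L x'" for x x'
      by (simp add: L_def plus_ell1_def scale_left_distrib sum.distrib)
    show "L (r *\<^sub>R x) = r *\<^sub>R L x" for r x
      by (simp add: L_def scaleR_ell1_def scaleR scaleR_sum_right)
    have "norm (v j) \<le> (\<Sum>k\<in>UNIV. norm (v k))" for j
      by (rule member_le_sum) auto
    from norm_scaled_sum_le[OF assms, of v, OF this]
    show "norm (L x) \<le> norm x * (\<Sum>k\<in>UNIV. norm (v k))" for x
      unfolding L_def by (simp add: mult.commute)
  qed
  then have S: "blinfun_apply (Blinfun L) = L" by (rule bounded_linear_Blinfun_apply)
  have "L (ell1_scale a x) = scaleY a (L x)" for a x
    by (simp add: L_def ell1_scale_def scale_sum_right)
  moreover have "L (ell1_axis j) = v j" for j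
  proof -
    have "L (ell1_axis j) = (\<Sum>k\<in>UNIV. if k = j then v k else 0)"
      unfolding L_def by (rule sum.cong) (auto simp: ell1_axis_def axis_def)
    then show ?thesis by simp
  qed
  ultimately show thesis
    using that[of "Blinfun L"] by (simp add: bounded_operators_def S)
qed


section \<open>The property\<close>

lemma norming_approx:
  assumes "norming scaleY I f" "0 \<le> r" "r < norm z"
  obtains i where "i \<in> I" "r < norm (blinfun_apply (f i) z)"
proof -
  have sup: "norm w = (SUP i\<in>I. norm (blinfun_apply (f i) w))" for w
    using assms(1) by (simp add: norming_def)
  \<comment> \<open>Over an empty index set the supremum is one constant for all vectors, which
    would force \<open>norm z = norm 0 = 0\<close>.\<close>
  have "I \<noteq> {}"
    using sup[of z] sup[of 0] assms(2,3) by auto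
  moreover have "bdd_above ((\<lambda>i. norm (blinfun_apply (f i) z)) ` I)"
  proof (rule bdd_aboveI2)
    fix i assume "i \<in> I"
    then have "norm (f i) = 1"
      using assms(1) by (simp add: norming_def dual_sphere_def)
    then show "norm (blinfun_apply (f i) z) \<le> norm z"
      using norm_blinfun[of "f i" z] by simp
  qed
  ultimately show thesis
    using assms(3) that unfolding sup[of z] by (auto simp: less_cSUP_iff)
qed

theorem proposition3p8:
  fixes scaleY :: "'k::real_or_complex \<Rightarrow> 'y::banach \<Rightarrow> 'y"
    and I :: "'i set"
    and y :: "'i \<Rightarrow> 'y"
    and f :: "'i \<Rightarrow> 'y \<Rightarrow>\<^sub>L 'k"
  assumes "banach_space_over scaleY"
    and "uniformly_strongly_exposed scaleY I y f"
    and "norming scaleY I f"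
  shows "property_Lpp (ell1_scale :: 'k \<Rightarrow> ('k, 'n::finite) ell1 \<Rightarrow> ('k, 'n) ell1) scaleY"
  unfolding property_Lpp_def
proof (intro allI impI ballI)
  interpret banach_space_over scaleY by fact
  have ns: "normed_space_over scaleY" by unfold_locales
  from assms(2) obtain \<delta> :: "real \<Rightarrow> real"
    where \<delta>_pos: "\<And>e. e \<in> {0<..<1} \<Longrightarrow> \<delta> e > 0"
      and exposed: "\<And>i e z. i \<in> I \<Longrightarrow> e \<in> {0<..<1} \<Longrightarrow> z \<in> cball 0 1 \<Longrightarrow>
        scalar_Re (blinfun_apply (f i) z) > 1 - \<delta> e \<Longrightarrow> norm (z - y i) < e"
    unfolding uniformly_strongly_exposed_def by blast
  have norm_y: "norm (y i) = 1" and f: "f i \<in> dual_sphere scaleY" if "i \<in> I" for i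
    using assms(2) that by (simp_all add: uniformly_strongly_exposed_def)
  fix \<epsilon> :: real and x :: "('k, 'n) ell1"
  assume "\<epsilon> > 0" and "x \<in> sphere 0 1"
  then have norm_x: "norm x = 1" by simp
  \<comment> \<open>Exposedness speaks only of values in (0,1). Halving leaves \<open>e\<close>
    strictly below \<epsilon>, so a non-strict bound by \<open>e\<close> suffices at the
    end.\<close>
  define e where "e = min \<epsilon> 1 / 2"
  have e: "e \<in> {0<..<1}" "e < \<epsilon>" using \<open>\<epsilon> > 0\<close> by (auto simp: e_def)
  define a where "a j = vec_of_ell1 x $ j" for j
  \<comment> \<open>Division by zero gives \<open>u j = 0\<close> off the support of
    \<open>x\<close>; on it \<open>u j\<close> is unimodular, and \<open>a j\<close> is
    \<open>norm (a j)\<close> times \<open>u j\<close> everywhere.\<close>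
  define u where "u j = a j / of_real (norm (a j))" for j
  have sum_a: "(\<Sum>j\<in>UNIV. norm (a j)) = 1" using norm_x by (simp add: norm_ell1_def a_def)
  have norm_u: "norm (u j) = 1" if "a j \<noteq> 0" for j using that by (simp add: u_def norm_divide)
  have norm_u_le: "norm (u j) \<le> 1" for j by (simp add: u_def norm_divide)
  \<comment> \<open>A positive lower bound for the nonzero weights, depending on \<open>x\<close>
    alone; the inserted 1 keeps the set nonempty for \<open>Min\<close>.\<close>
  define m where "m = Min (insert 1 ((\<lambda>j. norm (a j)) ` {j. a j \<noteq> 0}))"
  have "m > 0" by (simp add: m_def)
  have m_le: "m \<le> norm (a j)" if "a j \<noteq> 0" for j
    unfolding m_def using that by (intro Min_le) auto
  \<comment> \<open>The factor \<open>m\<close> absorbs the later division by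
    \<open>norm (a j)\<close>. The cap 1 keeps \<open>1 - \<eta>\<close> nonnegative, so that
    \<open>norming_approx\<close> applies and \<open>f i (T x)\<close> is nonzero.\<close>
  define \<eta> where "\<eta> = min 1 (\<delta> e * m)"
  have \<eta>: "\<eta> > 0" "\<eta> \<le> 1" "\<eta> \<le> \<delta> e * m"
    using \<delta>_pos[OF e(1)] \<open>m > 0\<close> by (auto simp: \<eta>_def)
  show "\<exists>\<eta>>0. \<forall>T\<in>bounded_operators ell1_scale scaleY.
      norm T = 1 \<and> norm (blinfun_apply T x) > 1 - \<eta> \<longrightarrow>
      (\<exists>S\<in>bounded_operators ell1_scale scaleY.
         norm S = 1 \<and> norm (blinfun_apply S x) = 1 \<and> norm (S - T) < \<epsilon>)"
  proof (intro exI[of _ \<eta>] conjI ballI impI)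
    fix T :: "('k, 'n) ell1 \<Rightarrow>\<^sub>L 'y"
    assume T: "T \<in> bounded_operators ell1_scale scaleY"
      and "norm T = 1 \<and> norm (blinfun_apply T x) > 1 - \<eta>"
    then have norm_T: "norm T = 1" and Tx: "1 - \<eta> < norm (T x)" by auto
    from norming_approx[OF assms(3) _ Tx] \<eta>(2) obtain i
      where i: "i \<in> I" and fTx: "1 - \<eta> < norm (f i (T x))" by auto
    have fi: "f i (scaleY b z) = b * f i z" "norm (f i) = 1" for b z
      using f[OF i] by (auto simp: dual_sphere_def bounded_operators_def)
    define t where "t j = T (ell1_axis j)" for j
    have norm_t: "norm (t j) \<le> 1" for j
      using norm_blinfun[of T "ell1_axis j"] by (simp add: t_def norm_T)
    define c where "c = of_real (norm (f i (T x))) / f i (T x)"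
    have "f i (T x) \<noteq> 0" using fTx \<eta>(2) by auto
    then have c: "norm c = 1" "c * f i (T x) = of_real (norm (f i (T x)))"
      by (auto simp: c_def norm_divide)
    have "c \<noteq> 0" using c(1) by auto
    \<comment> \<open>This is the value of \<open>f i\<close> at the rotated vector
      \<open>scaleY (c * u j) (t j)\<close>, to which exposedness will be applied.\<close>
    define g where "g j = c * (u j * f i (t j))" for j
    have "c * f i (T x) = (\<Sum>j\<in>UNIV. c * (a j * f i (t j)))"
      unfolding ell1_operator_apply[OF T, of x]
      by (simp add: blinfun.sum_right fi(1) sum_distrib_left a_def t_def)
    also have "\<dots> = (\<Sum>j\<in>UNIV. norm (a j) *\<^sub>R g j)"
      by (rule sum.cong) (simp_all add: g_def scaleR_conv_of_real u_def)
    finally have "norm (f i (T x)) = scalar_Re (\<Sum>j\<in>UNIV. norm (a j) *\<^sub>R g j)"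
      unfolding c(2) by (metis scalar_Re_of_real)
    then have mean: "1 - \<eta> < (\<Sum>j\<in>UNIV. norm (a j) * scalar_Re (g j))"
      using fTx by (simp add: scalar_Re_sum scalar_Re_scaleR)
    have g_le: "scalar_Re (g j) \<le> 1" for j
    proof -
      have "norm (f i (t j)) \<le> 1"
        using norm_blinfun[of "f i" "t j"] norm_t[of j] by (simp add: fi(2))
      then have "norm (g j) \<le> 1"
        using norm_u_le[of j] by (simp add: g_def norm_mult c(1) mult_le_one)
      then show ?thesis using scalar_Re_le_norm order_trans by blast
    qed
    have near: "norm (scaleY (c * u j) (t j) - y i) < e" if "a j \<noteq> 0" for j
    proof (rule exposed[OF i e(1)])
      show "scaleY (c * u j) (t j) \<in> cball 0 1"
        using norm_t[of j] by (simp add: norm_scale norm_mult c(1) norm_u[OF that])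
      have "norm (a j) * (1 - scalar_Re (g j)) < \<eta>"
        by (rule weighted_mean_near_bound[of UNIV]) (use sum_a g_le mean in auto)
      also have "\<eta> \<le> norm (a j) * \<delta> e"
        using \<eta>(3) mult_left_mono[OF m_le[OF that] less_imp_le[OF \<delta>_pos[OF e(1)]]]
        by (simp add: mult.commute)
      finally have "1 - scalar_Re (g j) < \<delta> e" using that by simp
      then show "1 - \<delta> e < scalar_Re (f i (scaleY (c * u j) (t j)))"
        by (simp add: fi(1) g_def mult.assoc)
    qed
    \<comment> \<open>Off the support \<open>T\<close> is left unchanged, so \<open>S - T\<close>
      vanishes there; on it the rotation by \<open>c * u j\<close> carries \<open>v j\<close>
      exactly to \<open>y i\<close>.\<close>
    define v where "v j = (if a j = 0 then t j else scaleY (inverse (c * u j)) (y i))" for j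
    obtain S :: "('k, 'n) ell1 \<Rightarrow>\<^sub>L 'y"
      where S: "S \<in> bounded_operators ell1_scale scaleY" and S_axis: "\<And>j. S (ell1_axis j) = v j"
      using ell1_operator_exists[OF ns] by blast
    have "norm (v j) \<le> 1" for j
      using norm_t[of j]
      by (simp add: v_def norm_scale norm_inverse norm_mult c(1) norm_u norm_y[OF i])
    then have S_le: "norm S \<le> 1"
      by (intro norm_ell1_operator_le[OF ns S]) (simp add: S_axis)
    \<comment> \<open>The phase of \<open>a j\<close> cancels against \<open>u j\<close>, so all
      terms of \<open>S x\<close> are nonnegative multiples of the one unit vector
      \<open>scaleY (inverse c) (y i)\<close>, and their weights add up to 1.\<close>
    have "scaleY (a j) (v j) = scaleY (of_real (norm (a j))) (scaleY (inverse c) (y i))" for j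
    proof (cases "a j = 0")
      case False
      then have "a j * inverse (c * u j) = of_real (norm (a j)) * inverse c"
        using \<open>c \<noteq> 0\<close> by (simp add: u_def field_simps)
      then show ?thesis using False by (simp add: v_def)
    qed simp
    then have "S x = (\<Sum>j\<in>UNIV. norm (a j) *\<^sub>R scaleY (inverse c) (y i))"
      unfolding ell1_operator_apply[OF S, of x]
      by (simp add: S_axis scale_of_real flip: a_def del: scale_scale)
    also have "\<dots> = scaleY (inverse c) (y i)"
      by (simp add: sum_a flip: scaleR_sum_left)
    finally have norm_Sx: "norm (S x) = 1"
      by (simp add: norm_scale norm_inverse c(1) norm_y[OF i])
    then have "norm S = 1"
      using S_le norm_blinfun[of S x] by (simp add: norm_x)
    moreover have "norm (S - T) \<le> e"
    proof (rule norm_ell1_operator_le[OF ns bounded_operators_diff[OF ns S T]])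
      fix j
      show "norm ((S - T) (ell1_axis j)) \<le> e"
      proof (cases "a j = 0")
        case True
        then show ?thesis using e(1) by (simp add: blinfun.diff_left S_axis v_def t_def)
      next
        case False
        have "norm (c * u j) = 1" by (simp add: norm_mult c(1) norm_u[OF False])
        moreover from this have "c * u j \<noteq> 0" by (metis norm_zero zero_neq_one)
        moreover have "(S - T) (ell1_axis j) = v j - t j"
          by (simp add: blinfun.diff_left S_axis t_def)
        \<comment> \<open>Multiplying by the unimodular scalar \<open>c * u j\<close> preserves the
          norm and turns the difference into the one estimated in \<open>near\<close>.\<close>
        ultimately have "norm ((S - T) (ell1_axis j)) = norm (scaleY (c * u j) (v j - t j))"
          by (simp add: norm_scale)
        also have "scaleY (c * u j) (v j - t j) = y i - scaleY (c * u j) (t j)"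
          using False right_inverse[OF \<open>c * u j \<noteq> 0\<close>]
          by (simp only: scale_right_diff_distrib v_def if_False scale_scale scale_one)
        finally show ?thesis using near[OF False] by (simp add: norm_minus_commute)
      qed
    qed
    ultimately show "\<exists>S\<in>bounded_operators ell1_scale scaleY.
        norm S = 1 \<and> norm (blinfun_apply S x) = 1 \<and> norm (S - T) < \<epsilon>"
      using S norm_Sx e(2) by force
  qed (rule \<eta>(1))
qed

end
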